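(* Let $a,b,c,d,e,k\in\mathbb{R}$ and consider the autonomous differential system $$\dot{x} = a(y-x)+yz,\qquad \dot{y} = b(x+y)-xz,\qquad \dot{z} = -cz-ew+xy,\qquad \dot{w} = -dw+kz+xy$$ on $\mathbb{R}^4$. Assume that $a\neq 0$, $d\neq e$, and define $$\Delta=a^2+6ab+b^2,\qquad \Gamma_{\pm}=\frac{b(cd+ek)\bigl(3a+b\pm\sqrt{\Delta}\bigr)}{a(d-e)}.$$ Then the system always admits the trivial equilibrium $E_0=(0,0,0,0)$. Moreover, whenever $\Delta\ge 0$, the system possesses the nontrivial equilibria $$E_-^\pm=\left(\pm\frac{\sqrt{\Gamma_-}}{\sqrt2},\ \mp\frac{a+b+\sqrt{\Delta}}{2\sqrt2\,b}\sqrt{\Gamma_-},\ \frac{-a+b-\sqrt{\Delta}}{2},\ -\frac{(c+k)(a-b+\sqrt{\Delta})}{2(d-e)}\right)$$ and $$E_+^\pm=\left(\pm\frac{\sqrt{\Gamma_+}}{\sqrt2},\ \mp\frac{a+b-\sqrt{\Delta}}{2\sqrt2\,b}\sqrt{\Gamma_+},\ \frac{-a+b+\sqrt{\Delta}}{2},\ \frac{(c+k)(-a+b+\sqrt{\Delta})}{2(d-e)}\right),$$ where the pair $E_-^\pm$ exists (as real points) whenever $\Gamma_-\ge 0$, and the pair $E_+^\pm$ exists whenever $\Gamma_+\ge 0$. Consequently, the system admits at most five real equilibrium points, namely $E_0$, $E_-^\pm$, $E_+^\pm$. Therefore, depending on the signs of $\Delta$, $\Gamma_-$ and $\Gamma_+$,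 the system may possess one, two, three, four, or five real equilibrium points.
   Context: An equilibrium of the system is a point $(x,y,z,w)\in\mathbb{R}^4$ at which all four right-hand sides vanish. In $E_-^\pm$ (and likewise in $E_+^\pm$) the upper signs are taken together and the lower signs are taken together.
   Formalization: Nontrivial equilibria are claimed for b≠0 (their formulas divide by b); "at most five" and the counts assume cd+ek≠0 (otherwise there are infinitely many equilibria); only 1, 3 and 5 are shown to be attained, since two and four never occur by the symmetry (x,y)→(−x,−y). *)

theory Defs
  imports Complex_Main
begin

definition rhs :: "real \<Rightarrow> real \<Rightarrow> real \<Rightarrow> real \<Rightarrow> real \<Rightarrow> real \<Rightarrow>
    real \<times> real \<times> real \<times> real \<Rightarrow> real \<times> real \<times> real \<times> real" where
  "rhs a b c d e k = (\<lambda>(x, y, z, w).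
     (a * (y - x) + y * z,
      b * (x + y) - x * z,
      - c * z - e * w + x * y,
      - d * w + k * z + x * y))"

definition equilibria :: "real \<Rightarrow> real \<Rightarrow> real \<Rightarrow> real \<Rightarrow> real \<Rightarrow> real \<Rightarrow>
    (real \<times> real \<times> real \<times> real) set" where
  "equilibria a b c d e k = {p. rhs a b c d e k p = (0, 0, 0, 0)}"

definition Delta :: "real \<Rightarrow> real \<Rightarrow> real" where
  "Delta a b = a\<^sup>2 + 6 * a * b + b\<^sup>2"

definition Gamma_minus :: "real \<Rightarrow> real \<Rightarrow> real \<Rightarrow> real \<Rightarrow> real \<Rightarrow> real \<Rightarrow> real" where
  "Gamma_minus a b c d e k =
     b * (c * d + e * k) * (3 * a + b - sqrt (Delta a b)) / (a * (d - e))"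

definition Gamma_plus :: "real \<Rightarrow> real \<Rightarrow> real \<Rightarrow> real \<Rightarrow> real \<Rightarrow> real \<Rightarrow> real" where
  "Gamma_plus a b c d e k =
     b * (c * d + e * k) * (3 * a + b + sqrt (Delta a b)) / (a * (d - e))"

definition E_zero :: "real \<times> real \<times> real \<times> real" where
  "E_zero = (0, 0, 0, 0)"

(* In E_minus and E_plus the argument s is the superscript sign: s = 1 selects the upper
   signs and s = -1 the lower signs. On reals, sqrt is odd and division by 0 yields 0, so
   these points (and Gamma_minus, Gamma_plus) carry their intended meaning only for
   Delta a b \<ge> 0, a nonnegative radicand, and nonzero a, b, d - e. *)

definition E_minus :: "real \<Rightarrow> real \<Rightarrow> real \<Rightarrow> real \<Rightarrow> real \<Rightarrow> real \<Rightarrow> real \<Rightarrow>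
    real \<times> real \<times> real \<times> real" where
  "E_minus s a b c d e k =
     (s * (sqrt (Gamma_minus a b c d e k) / sqrt 2),
      - s * ((a + b + sqrt (Delta a b)) / (2 * sqrt 2 * b) * sqrt (Gamma_minus a b c d e k)),
      (- a + b - sqrt (Delta a b)) / 2,
      - ((c + k) * (a - b + sqrt (Delta a b)) / (2 * (d - e))))"

definition E_plus :: "real \<Rightarrow> real \<Rightarrow> real \<Rightarrow> real \<Rightarrow> real \<Rightarrow> real \<Rightarrow> real \<Rightarrow>
    real \<times> real \<times> real \<times> real" where
  "E_plus s a b c d e k =
     (s * (sqrt (Gamma_plus a b c d e k) / sqrt 2),
      - s * ((a + b - sqrt (Delta a b)) / (2 * sqrt 2 * b) * sqrt (Gamma_plus a b c d e k)),
      (- a + b + sqrt (Delta a b)) / 2,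
      (c + k) * (- a + b + sqrt (Delta a b)) / (2 * (d - e)))"

(* The linear part in (z, w) is singular when c * d + e * k = 0; there is then a whole line of
   equilibria in the plane x = y = 0, so no finite bound on their number can hold. *)

lemma infinite_equilibria_if_singular:
  assumes "d \<noteq> e" and "c * d + e * k = 0"
  shows "infinite (equilibria a b c d e k)"
proof -
  obtain u v where uv: "(u, v) \<noteq> (0, 0)" "c * u + e * v = 0" "k * u = d * v"
  proof (cases "e = 0 \<and> c = 0")
    case True
    then show ?thesis using that[of d k] assms by auto
  next
    case False
    then show ?thesis using that[of e "- c"] assms by (auto simp: algebra_simps)
  qed
  define f where "f t = (0 :: real, 0 :: real, t * u, t * v)" for t :: real
  have "inj f" using uv(1) by (auto simp: inj_on_def f_def)
  moreover have "range f \<subseteq> equilibria a b c d e k"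
  proof (rule image_subsetI)
    fix t :: real
    have "- c * (t * u) - e * (t * v) = - t * (c * u + e * v)"
      and "- d * (t * v) + k * (t * u) = t * (k * u - d * v)"
      by (simp_all add: algebra_simps)
    then show "f t \<in> equilibria a b c d e k"
      using uv by (simp add: equilibria_def rhs_def f_def)
  qed
  ultimately show ?thesis
    using infinite_UNIV_char_0[where 'a = real] finite_subset finite_imageD by blast
qed

end

theory Submission
  imports Defs
begin

text \<open>
  The argument sorts the equilibria by their third coordinate. At an equilibrium the first two
  equations say \<open>y (a + z) = a x\<close> and \<open>x (z - b) = b y\<close>. If \<open>x y = 0\<close>, then \<open>(z, w)\<close> solves a
  homogeneous linear system of determinant \<open>c d + e k\<close>; in the nonsingular case \<open>z = w = 0\<close>, hence
  \<open>x = y = 0\<close>. Otherwise multiplying the two equations and cancelling \<open>x y\<close> gives \<open>(a + z) (z - b) = a b\<close>, that is \<open>z\<^sup>2 + (a - b) z = 2 a b\<close>: a quadratic of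
  discriminant \<open>Delta\<close>, whose roots are the heights of \<open>E_minus\<close> and \<open>E_plus\<close>.

  At a fixed root \<open>r\<close>, lemma \<open>equilibrium_at_root_iff\<close> solves the system: \<open>y\<close> is a fixed multiple
  of \<open>x\<close>, \<open>w\<close> is determined by \<open>r\<close>, and the one remaining condition prescribes \<open>x\<^sup>2\<close>, namely as half
  of the \<open>Gamma\<close> belonging to \<open>r\<close>. A root therefore carries two equilibria, or none, according to
  the sign of \<open>Gamma\<close>; the value 0 is excluded in the nonsingular case with \<open>b \<noteq> 0\<close> because
  \<open>(3 a + b)\<^sup>2 - Delta = 8 a\<^sup>2\<close>. The origin has height 0, which is not a root if \<open>b \<noteq> 0\<close>, so the counts
  simply add up, except that the two roots coincide when \<open>Delta = 0\<close>.

  The identity just quoted also shows that \<open>Gamma_minus\<close> and \<open>Gamma_plus\<close> always have the same sign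
  when \<open>Delta \<ge> 0\<close>. Three equilibria therefore occur only for \<open>Delta = 0\<close>, which is why the example
  with three equilibria takes \<open>b\<close> to be a root of \<open>1 + 6 b + b\<^sup>2\<close>.
\<close>

section \<open>The equations at a given height\<close>

definition equilibria_at_height ::
    "real \<Rightarrow> real \<Rightarrow> real \<Rightarrow> real \<Rightarrow> real \<Rightarrow> real \<Rightarrow> real \<Rightarrow> (real \<times> real \<times> real \<times> real) set" where
  "equilibria_at_height a b c d e k r = {p \<in> equilibria a b c d e k. fst (snd (snd p)) = r}"

definition height_minus :: "real \<Rightarrow> real \<Rightarrow> real" where
  "height_minus a b = (- a + b - sqrt (Delta a b)) / 2"

definition height_plus :: "real \<Rightarrow> real \<Rightarrow> real" where
  "height_plus a b = (- a + b + sqrt (Delta a b)) / 2"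

lemma equilibria_iff:
  "(x, y, z, w) \<in> equilibria a b c d e k \<longleftrightarrow>
     a * (y - x) + y * z = 0 \<and> b * (x + y) - x * z = 0
     \<and> - c * z - e * w + x * y = 0 \<and> - d * w + k * z + x * y = 0"
  by (simp add: equilibria_def rhs_def)

lemma E_zero_equilibrium: "E_zero \<in> equilibria a b c d e k"
  by (simp add: E_zero_def equilibria_iff)

text \<open>
  Here \<open>q\<close> stands for the product \<open>x y\<close> common to the last two equations. Subtracting the equations
  eliminates \<open>q\<close>; weighting them by \<open>d\<close> and \<open>- e\<close> eliminates \<open>w\<close>.
\<close>

lemma last_two_equations_iff:
  fixes c d e k z w q :: real
  assumes "d \<noteq> e"
  shows "- c * z - e * w + q = 0 \<and> - d * w + k * z + q = 0 \<longleftrightarrow>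
    w = (c + k) * z / (d - e) \<and> q = (c * d + e * k) * z / (d - e)"
proof -
  have de: "d - e \<noteq> 0" using assms by simp
  have w: "w = (c + k) * z / (d - e) \<longleftrightarrow> w * (d - e) = (c + k) * z"
    and q: "q = (c * d + e * k) * z / (d - e) \<longleftrightarrow> q * (d - e) = (c * d + e * k) * z"
    using de by (simp_all add: eq_divide_eq)
  show ?thesis unfolding w q
  proof
    assume "- c * z - e * w + q = 0 \<and> - d * w + k * z + q = 0"
    then show "w * (d - e) = (c + k) * z \<and> q * (d - e) = (c * d + e * k) * z"
      by algebra
  next
    assume *: "w * (d - e) = (c + k) * z \<and> q * (d - e) = (c * d + e * k) * z"
    then have "(d - e) * (- c * z - e * w + q) = 0" "(d - e) * (- d * w + k * z + q) = 0"
      by algebra+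
    with de show "- c * z - e * w + q = 0 \<and> - d * w + k * z + q = 0" by simp
  qed
qed

text \<open>
  Multiplying the first two equations gives \<open>(a + z) (z - b) x y = a b x y\<close>, and \<open>x y\<close> can be
  cancelled since otherwise \<open>z\<close> and \<open>w\<close> would solve a nonsingular homogeneous system. If \<open>b = 0\<close>, the
  second equation forces \<open>x z = 0\<close>, which makes \<open>x y\<close> vanish as well.
\<close>

lemma nonzero_equilibrium_height:
  assumes "a \<noteq> 0" and de: "d \<noteq> e" and ns: "c * d + e * k \<noteq> 0"
    and eq: "(x, y, z, w) \<in> equilibria a b c d e k" and nz: "(x, y, z, w) \<noteq> E_zero"
  shows "b \<noteq> 0" and "z\<^sup>2 + (a - b) * z = 2 * a * b"
proof -
  have e1: "a * (y - x) + y * z = 0" and e2: "b * (x + y) - x * z = 0"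
    using eq by (auto simp: equilibria_iff)
  have w: "w = (c + k) * z / (d - e)" and xy: "x * y = (c * d + e * k) * z / (d - e)"
    using eq last_two_equations_iff[OF de, of c z w "x * y" k] by (auto simp: equilibria_iff)
  have xy0: "x * y \<noteq> 0"
  proof
    assume "x * y = 0"
    then have "z = 0" using xy ns de by simp
    moreover from this have "x = y" using e1 \<open>a \<noteq> 0\<close> by simp
    ultimately show False using \<open>x * y = 0\<close> w nz by (simp add: E_zero_def)
  qed
  show "b \<noteq> 0"
  proof
    assume "b = 0"
    then have "z = 0" using e2 xy0 by simp
    then show False using xy xy0 by simp
  qed
  have "x * y * (z\<^sup>2 + (a - b) * z - 2 * a * b) = 0" using e1 e2 by algebra
  then show "z\<^sup>2 + (a - b) * z = 2 * a * b" using xy0 by simp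
qed

text \<open>
  On a root of the quadratic the first two equations are proportional, so \<open>y = x (r - b) / b\<close>
  replaces both. The product \<open>x y\<close> prescribed by the last two equations then becomes a condition
  on \<open>x\<^sup>2\<close>, simplified by means of \<open>r / (r - b) = (r + 2 a) / a\<close>.
\<close>

lemma equilibrium_at_root_iff:
  assumes "a \<noteq> 0" and "b \<noteq> 0" and de: "d \<noteq> e" and root: "r\<^sup>2 + (a - b) * r = 2 * a * b"
  shows "(x, y, r, w) \<in> equilibria a b c d e k \<longleftrightarrow>
    y = x * (r - b) / b \<and> w = (c + k) * r / (d - e)
    \<and> x\<^sup>2 = b * (c * d + e * k) * (r + 2 * a) / (a * (d - e))"
proof -
  have de0: "d - e \<noteq> 0" using de by simp
  have prod: "(r - b) * (r + a) = a * b" using root by algebra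
  then have rb: "r - b \<noteq> 0" using assms(1,2) by auto
  have ratio: "r * a = (r - b) * (r + 2 * a)" using root by algebra
  have first_two: "a * (y - x) + y * r = 0 \<and> b * (x + y) - x * r = 0 \<longleftrightarrow> y = x * (r - b) / b"
  proof -
    have "b * (x + y) - x * r = 0 \<longleftrightarrow> y = x * (r - b) / b"
      using \<open>b \<noteq> 0\<close> by (auto simp: field_simps)
    moreover have "a * (y - x) + y * r = 0" if "b * (x + y) - x * r = 0"
    proof -
      have "b * (a * (y - x) + y * r) = 0" using that root by algebra
      then show ?thesis using \<open>b \<noteq> 0\<close> by simp
    qed
    ultimately show ?thesis by blast
  qed
  have square: "x * (x * (r - b) / b) = (c * d + e * k) * r / (d - e) \<longleftrightarrow>
      x\<^sup>2 = b * (c * d + e * k) * (r + 2 * a) / (a * (d - e))" (is "?L = ?R \<longleftrightarrow> ?S = ?T")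
  proof -
    have "?L = ?S * (r - b) / b"
      by (simp add: power2_eq_square)
    moreover have "?R = ?T * (r - b) / b"
    proof -
      have "?T * (r - b) / b = (c * d + e * k) * ((r - b) * (r + 2 * a)) / (a * (d - e))"
        using \<open>b \<noteq> 0\<close> by simp
      also have "\<dots> = ?R" unfolding ratio[symmetric] using \<open>a \<noteq> 0\<close> by simp
      finally show ?thesis by simp
    qed
    moreover have "u * (r - b) / b = v * (r - b) / b \<longleftrightarrow> u = v" for u v
      using rb \<open>b \<noteq> 0\<close> by simp
    ultimately show ?thesis by (simp only:)
  qed
  show ?thesis
    using first_two last_two_equations_iff[OF de, of c r w "x * y" k] square
    unfolding equilibria_iff by auto
qed

section \<open>The two roots and the named equilibria\<close>

lemma height_quadratic_iff:
  "z\<^sup>2 + (a - b) * z = 2 * a * b \<longleftrightarrow>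
     Delta a b \<ge> 0 \<and> (z = height_minus a b \<or> z = height_plus a b)"
proof -
  define s where "s = sqrt (Delta a b)"
  have sq: "z\<^sup>2 + (a - b) * z = 2 * a * b \<longleftrightarrow> (2 * z + a - b)\<^sup>2 = Delta a b"
    unfolding Delta_def by (auto simp: power2_eq_square algebra_simps)
  show ?thesis
  proof (cases "Delta a b \<ge> 0")
    case True
    then have "Delta a b = s\<^sup>2" by (simp add: s_def)
    then show ?thesis using True unfolding sq height_minus_def height_plus_def
      by (auto simp: power2_eq_iff s_def[symmetric] field_simps)
  next
    case False
    then show ?thesis using sq by (metis zero_le_power2)
  qed
qed

lemma quadratic_root_nonzero:
  fixes a b r :: real
  assumes "a \<noteq> 0" "b \<noteq> 0" "r\<^sup>2 + (a - b) * r = 2 * a * b"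
  shows "r \<noteq> 0"
  using assms by auto

lemma Gamma_minus_half:
  "Gamma_minus a b c d e k / 2 =
     b * (c * d + e * k) * (height_minus a b + 2 * a) / (a * (d - e))"
proof -
  have height: "height_minus a b + 2 * a = (3 * a + b - sqrt (Delta a b)) / 2"
    by (simp add: height_minus_def field_simps)
  show ?thesis unfolding height Gamma_minus_def by simp
qed

lemma Gamma_plus_half:
  "Gamma_plus a b c d e k / 2 =
     b * (c * d + e * k) * (height_plus a b + 2 * a) / (a * (d - e))"
proof -
  have height: "height_plus a b + 2 * a = (3 * a + b + sqrt (Delta a b)) / 2"
    by (simp add: height_plus_def field_simps)
  show ?thesis unfolding height Gamma_plus_def by simp
qed

lemma E_minus_alt:
  shows "E_minus s a b c d e k =
    (let x = s * sqrt (Gamma_minus a b c d e k / 2); r = height_minus a b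
     in (x, x * (r - b) / b, r, (c + k) * r / (d - e)))"
proof -
  have diff: "height_minus a b - b = - (a + b + sqrt (Delta a b)) / 2"
    and h: "height_minus a b = - (a - b + sqrt (Delta a b)) / 2"
    by (simp_all add: height_minus_def field_simps)
  have y: "s * (g / sqrt 2) * (- q / 2) / b = - s * (q / (2 * sqrt 2 * b) * g)" for q g
    by (simp add: mult.commute mult.left_commute)
  have w: "(c + k) * (- q / 2) / (d - e) = - ((c + k) * q / (2 * (d - e)))" for q
    by simp
  have "(c + k) * height_minus a b / (d - e)
      = - ((c + k) * (a - b + sqrt (Delta a b)) / (2 * (d - e)))"
    unfolding h by (rule w)
  then show ?thesis
    unfolding E_minus_def Let_def real_sqrt_divide diff y by (simp only: height_minus_def)
qed

lemma E_plus_alt: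
  shows "E_plus s a b c d e k =
    (let x = s * sqrt (Gamma_plus a b c d e k / 2); r = height_plus a b
     in (x, x * (r - b) / b, r, (c + k) * r / (d - e)))"
proof -
  have diff: "height_plus a b - b = - (a + b - sqrt (Delta a b)) / 2"
    by (simp add: height_plus_def field_simps)
  have y: "s * (g / sqrt 2) * (- q / 2) / b = - s * (q / (2 * sqrt 2 * b) * g)" for q g
    by (simp add: mult.commute mult.left_commute)
  have w: "(c + k) * (q / 2) / (d - e) = (c + k) * q / (2 * (d - e))" for q
    by simp
  show ?thesis
    unfolding E_plus_def Let_def real_sqrt_divide diff y by (simp only: height_plus_def w)
qed

lemma real_square_eq_iff:
  fixes x t :: real
  shows "x\<^sup>2 = t \<longleftrightarrow> t \<ge> 0 \<and> (\<exists>s\<in>{1, -1}. x = s * sqrt t)"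
proof (cases "t \<ge> 0")
  case True
  then have "x\<^sup>2 = t \<longleftrightarrow> x\<^sup>2 = (sqrt t)\<^sup>2" by simp
  then show ?thesis using True unfolding power2_eq_iff by simp
next
  case False
  then show ?thesis by (metis zero_le_power2)
qed

lemma equilibria_at_root:
  assumes "a \<noteq> 0" "b \<noteq> 0" "d \<noteq> e" "r\<^sup>2 + (a - b) * r = 2 * a * b"
  shows "equilibria_at_height a b c d e k r =
    (\<lambda>x. (x, x * (r - b) / b, r, (c + k) * r / (d - e))) `
      {x. x\<^sup>2 = b * (c * d + e * k) * (r + 2 * a) / (a * (d - e))}"
  unfolding equilibria_at_height_def
  by (auto simp: equilibrium_at_root_iff[OF assms] image_iff)

lemma equilibria_at_height_minus:
  assumes "a \<noteq> 0" "b \<noteq> 0" "d \<noteq> e" "Delta a b \<ge> 0"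
  shows "equilibria_at_height a b c d e k (height_minus a b) =
    {p. Gamma_minus a b c d e k \<ge> 0 \<and> (\<exists>s\<in>{1, -1}. p = E_minus s a b c d e k)}"
proof -
  have "(height_minus a b)\<^sup>2 + (a - b) * height_minus a b = 2 * a * b"
    using assms(4) height_quadratic_iff by blast
  from equilibria_at_root[OF assms(1-3) this] show ?thesis
    unfolding Gamma_minus_half[symmetric] real_square_eq_iff E_minus_alt Let_def
    by auto
qed

lemma equilibria_at_height_plus:
  assumes "a \<noteq> 0" "b \<noteq> 0" "d \<noteq> e" "Delta a b \<ge> 0"
  shows "equilibria_at_height a b c d e k (height_plus a b) =
    {p. Gamma_plus a b c d e k \<ge> 0 \<and> (\<exists>s\<in>{1, -1}. p = E_plus s a b c d e k)}"
proof -
  have "(height_plus a b)\<^sup>2 + (a - b) * height_plus a b = 2 * a * b"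
    using assms(4) height_quadratic_iff by blast
  from equilibria_at_root[OF assms(1-3) this] show ?thesis
    unfolding Gamma_plus_half[symmetric] real_square_eq_iff E_plus_alt Let_def
    by auto
qed

text \<open>
  A root is nonzero, so even in the degenerate case \<open>c d + e k = 0\<close>, where both \<open>x\<close> and \<open>y\<close> vanish,
  these equilibria differ from the origin in their third coordinate.
\<close>

lemma named_equilibria_nonzero:
  assumes "a \<noteq> 0" "b \<noteq> 0" "Delta a b \<ge> 0"
  shows "E_minus s a b c d e k \<noteq> E_zero" and "E_plus s a b c d e k \<noteq> E_zero"
proof -
  have "height_minus a b \<noteq> 0" "height_plus a b \<noteq> 0"
    using assms height_quadratic_iff quadratic_root_nonzero by blast+
  then show "E_minus s a b c d e k \<noteq> E_zero" "E_plus s a b c d e k \<noteq> E_zero"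
    by (simp_all add: E_minus_alt E_plus_alt Let_def E_zero_def)
qed

section \<open>Counting the equilibria\<close>

text \<open>
  The radicand \<open>x\<^sup>2\<close> cannot be 0: the root \<open>r = - 2 a\<close> would give \<open>2 a\<^sup>2 = 0\<close> in the quadratic.
  This is the identity \<open>(3 a + b)\<^sup>2 - Delta = 8 a\<^sup>2\<close> in terms of \<open>r\<close>.
\<close>

lemma card_equilibria_at_root:
  assumes "a \<noteq> 0" "b \<noteq> 0" "d \<noteq> e" "r\<^sup>2 + (a - b) * r = 2 * a * b" "c * d + e * k \<noteq> 0"
  defines "t \<equiv> b * (c * d + e * k) * (r + 2 * a) / (a * (d - e))"
  shows "finite (equilibria_at_height a b c d e k r)"
    and "card (equilibria_at_height a b c d e k r) = (if t > 0 then 2 else 0)"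
proof -
  let ?f = "\<lambda>x. (x, x * (r - b) / b, r, (c + k) * r / (d - e))"
  have slice: "equilibria_at_height a b c d e k r = ?f ` {x. x\<^sup>2 = t}"
    unfolding t_def by (rule equilibria_at_root[OF assms(1-4)])
  have "r + 2 * a \<noteq> 0"
  proof
    assume "r + 2 * a = 0"
    then have "a * a = 0" using assms(4) by algebra
    then show False using assms(1) by simp
  qed
  then have "t \<noteq> 0" using assms(1-3,5) by (simp add: t_def)
  have roots: "{x. x\<^sup>2 = t} = (if t > 0 then {sqrt t, - sqrt t} else {})"
    using \<open>t \<noteq> 0\<close> by (auto simp: real_square_eq_iff)
  show "finite (equilibria_at_height a b c d e k r)"
    unfolding slice roots by simp
  have "card (equilibria_at_height a b c d e k r) = card {x. x\<^sup>2 = t}"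
    unfolding slice by (rule card_image) (simp add: inj_on_def)
  also have "\<dots> = (if t > 0 then 2 else 0)"
    unfolding roots by simp
  finally show "card (equilibria_at_height a b c d e k r) = (if t > 0 then 2 else 0)" .
qed

lemma equilibria_trivial:
  assumes "a \<noteq> 0" "d \<noteq> e" "c * d + e * k \<noteq> 0" "b = 0 \<or> Delta a b < 0"
  shows "equilibria a b c d e k = {E_zero}"
proof -
  have "p = E_zero" if p: "p \<in> equilibria a b c d e k" for p
  proof (rule ccontr)
    assume nz: "p \<noteq> E_zero"
    obtain x y z w where "p = (x, y, z, w)" by (cases p)
    with nonzero_equilibrium_height[OF assms(1-3)] p nz
    have "b \<noteq> 0" "z\<^sup>2 + (a - b) * z = 2 * a * b" by blast+
    with assms(4) show False using height_quadratic_iff[of z a b] by simp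
  qed
  then show ?thesis using E_zero_equilibrium by blast
qed

lemma equilibria_decomposition:
  assumes "a \<noteq> 0" "d \<noteq> e" "c * d + e * k \<noteq> 0"
  shows "equilibria a b c d e k =
    insert E_zero (equilibria_at_height a b c d e k (height_minus a b)
                   \<union> equilibria_at_height a b c d e k (height_plus a b))"
    (is "_ = ?rhs")
proof
  show "equilibria a b c d e k \<subseteq> ?rhs"
  proof
    fix p assume p: "p \<in> equilibria a b c d e k"
    obtain x y z w where pe: "p = (x, y, z, w)" by (cases p)
    show "p \<in> ?rhs"
    proof (cases "p = E_zero")
      case False
      then have "z\<^sup>2 + (a - b) * z = 2 * a * b"
        using nonzero_equilibrium_height(2)[OF assms] p pe by blast
      then have "z = height_minus a b \<or> z = height_plus a b"
        using height_quadratic_iff by blast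
      then show ?thesis using p pe by (auto simp: equilibria_at_height_def)
    qed simp
  qed
  show "?rhs \<subseteq> equilibria a b c d e k"
    using E_zero_equilibrium by (auto simp: equilibria_at_height_def)
qed

lemma card_equilibria:
  assumes "a \<noteq> 0" "b \<noteq> 0" "d \<noteq> e" "c * d + e * k \<noteq> 0" "Delta a b \<ge> 0"
  shows "finite (equilibria a b c d e k)"
    and "Delta a b = 0 \<Longrightarrow>
      card (equilibria a b c d e k) = (if Gamma_minus a b c d e k > 0 then 3 else 1)"
    and "Delta a b > 0 \<Longrightarrow>
      card (equilibria a b c d e k) = 1 + (if Gamma_minus a b c d e k > 0 then 2 else 0)
        + (if Gamma_plus a b c d e k > 0 then 2 else 0)"
proof -
  define M where "M = equilibria_at_height a b c d e k (height_minus a b)"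
  define P where "P = equilibria_at_height a b c d e k (height_plus a b)"
  have rm: "(height_minus a b)\<^sup>2 + (a - b) * height_minus a b = 2 * a * b"
    and rp: "(height_plus a b)\<^sup>2 + (a - b) * height_plus a b = 2 * a * b"
    using assms(5) height_quadratic_iff by blast+
  have M: "finite M" "card M = (if Gamma_minus a b c d e k > 0 then 2 else 0)"
    using card_equilibria_at_root[OF assms(1-3) rm assms(4)]
    unfolding M_def Gamma_minus_half[symmetric] by simp_all
  have P: "finite P" "card P = (if Gamma_plus a b c d e k > 0 then 2 else 0)"
    using card_equilibria_at_root[OF assms(1-3) rp assms(4)]
    unfolding P_def Gamma_plus_half[symmetric] by simp_all
  have eq: "equilibria a b c d e k = insert E_zero (M \<union> P)"
    unfolding M_def P_def by (rule equilibria_decomposition[OF assms(1,3,4)])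
  show "finite (equilibria a b c d e k)" using eq M P by simp
  have "E_zero \<notin> M \<union> P"
    using quadratic_root_nonzero[OF assms(1,2)] rm rp
    by (auto simp: M_def P_def equilibria_at_height_def E_zero_def)
  then have card: "card (equilibria a b c d e k) = 1 + card (M \<union> P)"
    using eq M P by simp
  show "card (equilibria a b c d e k) = (if Gamma_minus a b c d e k > 0 then 3 else 1)"
    if "Delta a b = 0"
  proof -
    have "P = M" using that by (simp add: M_def P_def height_minus_def height_plus_def)
    then show ?thesis using card M by simp
  qed
  show "card (equilibria a b c d e k) = 1 + (if Gamma_minus a b c d e k > 0 then 2 else 0)
      + (if Gamma_plus a b c d e k > 0 then 2 else 0)" if "Delta a b > 0"
  proof -
    have "height_minus a b \<noteq> height_plus a b"
      using that by (simp add: height_minus_def height_plus_def)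
    then have "M \<inter> P = {}" by (auto simp: M_def P_def equilibria_at_height_def)
    then have "card (M \<union> P) = card M + card P" using M P by (simp add: card_Un_disjoint)
    then show ?thesis using card M P by simp
  qed
qed

section \<open>Parameters realising one, three and five equilibria\<close>

lemma one_equilibrium_example: "card (equilibria 1 (-1) 1 1 0 0) = 1"
  by (subst equilibria_trivial) (simp_all add: Delta_def)

text \<open>
  Here \<open>b = 2 sqrt 2 - 3\<close> makes \<open>Delta\<close> vanish; as \<open>b < 0 < 3 + b\<close>, the choice \<open>c d + e k = - 1\<close> makes
  the common value of the two radicands positive.
\<close>

lemma three_equilibria_example:
  "card (equilibria 1 (2 * sqrt 2 - 3) (-1) 1 0 0) = 3"
proof -
  define b :: real where "b = 2 * sqrt 2 - 3"
  have "(2 * sqrt 2)\<^sup>2 < (3 :: real)\<^sup>2" by (simp add: power_mult_distrib)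
  then have "2 * sqrt 2 < (3 :: real)" by (rule power2_less_imp_less) simp
  then have b: "b < 0" "3 + b > 0" by (simp_all add: b_def)
  have "(b + 3)\<^sup>2 = 8" by (simp add: b_def power_mult_distrib)
  then have D: "Delta 1 b = 0" by (simp add: Delta_def power2_eq_square algebra_simps)
  have "Gamma_minus 1 b (-1) 1 0 0 > 0"
    using b D by (simp add: Gamma_minus_def mult_neg_pos)
  then show ?thesis using card_equilibria(2)[of 1 b 1 0 "-1" 0] b(1) D by (simp add: b_def)
qed

lemma five_equilibria_example: "card (equilibria 1 1 1 1 0 0) = 5"
proof -
  have D: "Delta 1 1 = 8" by (simp add: Delta_def)
  have "sqrt 8 < sqrt ((4 :: real)\<^sup>2)" by (rule real_sqrt_less_mono) simp
  then have s: "sqrt 8 < (4 :: real)" "sqrt 8 > (0 :: real)" by simp_all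
  have "4 + sqrt 8 > (0 :: real)" using s(2) by linarith
  then have "Gamma_minus 1 1 1 1 0 0 > 0" "Gamma_plus 1 1 1 1 0 0 > 0"
    using s(1) unfolding Gamma_minus_def Gamma_plus_def D by simp_all
  then show ?thesis using card_equilibria(3)[of 1 1 1 0 1 0] D by simp
qed

section \<open>The classification\<close>

theorem proposition1:
  fixes a b c d e k :: real
  assumes "a \<noteq> 0" and "d \<noteq> e"
  shows
    "E_zero \<in> equilibria a b c d e k
     \<and> (b \<noteq> 0 \<and> Delta a b \<ge> 0 \<longrightarrow>
          (Gamma_minus a b c d e k \<ge> 0 \<longrightarrow>
             (\<forall>s\<in>{1, -1}. E_minus s a b c d e k \<in> equilibria a b c d e k
                \<and> E_minus s a b c d e k \<noteq> E_zero))
          \<and> (Gamma_plus a b c d e k \<ge> 0 \<longrightarrow>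
             (\<forall>s\<in>{1, -1}. E_plus s a b c d e k \<in> equilibria a b c d e k
                \<and> E_plus s a b c d e k \<noteq> E_zero)))
     \<and> (c * d + e * k \<noteq> 0 \<longrightarrow>
          (\<forall>p\<in>equilibria a b c d e k.
             p = E_zero
             \<or> (Delta a b \<ge> 0 \<and> Gamma_minus a b c d e k \<ge> 0
                 \<and> (\<exists>s\<in>{1, -1}. p = E_minus s a b c d e k))
             \<or> (Delta a b \<ge> 0 \<and> Gamma_plus a b c d e k \<ge> 0
                 \<and> (\<exists>s\<in>{1, -1}. p = E_plus s a b c d e k)))
          \<and> finite (equilibria a b c d e k)
          \<and> card (equilibria a b c d e k) \<le> 5
          \<and> card (equilibria a b c d e k) \<in> {1, 2, 3, 4, 5}
          \<and> (Delta a b < 0 \<longrightarrow> card (equilibria a b c d e k) = 1)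
          \<and> (Delta a b = 0 \<longrightarrow>
               card (equilibria a b c d e k) = (if Gamma_minus a b c d e k > 0 then 3 else 1))
          \<and> (Delta a b > 0 \<longrightarrow>
               card (equilibria a b c d e k) =
                 1 + (if Gamma_minus a b c d e k > 0 then 2 else 0)
                   + (if Gamma_plus a b c d e k > 0 then 2 else 0)))
     \<and> (\<forall>n\<in>{1, 3, 5}. \<exists>a' b' c' d' e' k' :: real.
          a' \<noteq> 0 \<and> b' \<noteq> 0 \<and> d' \<noteq> e' \<and> c' * d' + e' * k' \<noteq> 0
          \<and> card (equilibria a' b' c' d' e' k') = n)"
proof (intro conjI impI)
  show "E_zero \<in> equilibria a b c d e k" by (rule E_zero_equilibrium)
next
  assume b: "b \<noteq> 0 \<and> Delta a b \<ge> 0" and "Gamma_minus a b c d e k \<ge> 0"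
  then have "E_minus s a b c d e k \<in> equilibria_at_height a b c d e k (height_minus a b)"
    if "s \<in> {1, -1}" for s
    using that equilibria_at_height_minus[of a b d e c k] assms by blast
  then show "\<forall>s\<in>{1, -1}. E_minus s a b c d e k \<in> equilibria a b c d e k
      \<and> E_minus s a b c d e k \<noteq> E_zero"
    using named_equilibria_nonzero(1)[of a b] assms(1) b by (auto simp: equilibria_at_height_def)
next
  assume b: "b \<noteq> 0 \<and> Delta a b \<ge> 0" and "Gamma_plus a b c d e k \<ge> 0"
  then have "E_plus s a b c d e k \<in> equilibria_at_height a b c d e k (height_plus a b)"
    if "s \<in> {1, -1}" for s
    using that equilibria_at_height_plus[of a b d e c k] assms by blast
  then show "\<forall>s\<in>{1, -1}. E_plus s a b c d e k \<in> equilibria a b c d e k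
      \<and> E_plus s a b c d e k \<noteq> E_zero"
    using named_equilibria_nonzero(2)[of a b] assms(1) b by (auto simp: equilibria_at_height_def)
next
  assume ns: "c * d + e * k \<noteq> 0"
  note triv = equilibria_trivial[OF assms ns]
  show "\<forall>p\<in>equilibria a b c d e k.
      p = E_zero
      \<or> (Delta a b \<ge> 0 \<and> Gamma_minus a b c d e k \<ge> 0
          \<and> (\<exists>s\<in>{1, -1}. p = E_minus s a b c d e k))
      \<or> (Delta a b \<ge> 0 \<and> Gamma_plus a b c d e k \<ge> 0
          \<and> (\<exists>s\<in>{1, -1}. p = E_plus s a b c d e k))"
  proof (cases "b = 0 \<or> Delta a b < 0")
    case True
    then show ?thesis using triv by simp
  next
    case False
    then have nd: "b \<noteq> 0" "Delta a b \<ge> 0" by auto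
    show ?thesis
      unfolding equilibria_decomposition[OF assms ns]
        equilibria_at_height_minus[OF assms(1) nd(1) assms(2) nd(2)]
        equilibria_at_height_plus[OF assms(1) nd(1) assms(2) nd(2)]
      using nd(2) by blast
  qed
  have fin: "finite (equilibria a b c d e k)"
    using triv card_equilibria(1)[of a b d e c k] assms ns by fastforce
  then show "finite (equilibria a b c d e k)" .
  have neg: "card (equilibria a b c d e k) = 1" if "Delta a b < 0"
    using triv that by simp
  have zero: "card (equilibria a b c d e k) = (if Gamma_minus a b c d e k > 0 then 3 else 1)"
    if D: "Delta a b = 0"
  proof -
    have "b \<noteq> 0" using D assms(1) by (auto simp: Delta_def)
    then show ?thesis using card_equilibria(2)[OF assms(1) _ assms(2) ns _ D] D by simp
  qed
  have pos: "card (equilibria a b c d e k) =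
      1 + (if Gamma_minus a b c d e k > 0 then 2 else 0)
        + (if Gamma_plus a b c d e k > 0 then 2 else 0)" if D: "Delta a b > 0"
  proof (cases "b = 0")
    case True
    then show ?thesis using triv by (simp add: Gamma_minus_def Gamma_plus_def)
  next
    case False
    then show ?thesis using card_equilibria(3)[OF assms(1) _ assms(2) ns _ D] D by simp
  qed
  show "Delta a b < 0 \<Longrightarrow> card (equilibria a b c d e k) = 1" by (rule neg)
  show "Delta a b = 0 \<Longrightarrow>
      card (equilibria a b c d e k) = (if Gamma_minus a b c d e k > 0 then 3 else 1)"
    by (rule zero)
  show "Delta a b > 0 \<Longrightarrow> card (equilibria a b c d e k) =
      1 + (if Gamma_minus a b c d e k > 0 then 2 else 0)
        + (if Gamma_plus a b c d e k > 0 then 2 else 0)"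
    by (rule pos)
  have "card (equilibria a b c d e k) \<in> {1, 3, 5}"
    using neg zero pos by (cases "Delta a b" "0 :: real" rule: linorder_cases) simp_all
  then show "card (equilibria a b c d e k) \<le> 5"
    and "card (equilibria a b c d e k) \<in> {1, 2, 3, 4, 5}" by auto
next
  have one: "(1 :: real) \<noteq> 0 \<and> (-1 :: real) \<noteq> 0 \<and> (1 :: real) \<noteq> 0 \<and> 1 * 1 + 0 * 0 \<noteq> (0 :: real)
      \<and> card (equilibria 1 (-1) 1 1 0 0) = 1"
    using one_equilibrium_example by simp
  have "2 * sqrt 2 - 3 \<noteq> (0 :: real)"
  proof
    assume "2 * sqrt 2 - 3 = (0 :: real)"
    then have "(2 * sqrt 2)\<^sup>2 = (3 :: real)\<^sup>2" by simp
    then show False by (simp add: power_mult_distrib)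
  qed
  then have three: "(1 :: real) \<noteq> 0 \<and> 2 * sqrt 2 - 3 \<noteq> (0 :: real) \<and> (1 :: real) \<noteq> 0
      \<and> - 1 * 1 + 0 * 0 \<noteq> (0 :: real) \<and> card (equilibria 1 (2 * sqrt 2 - 3) (-1) 1 0 0) = 3"
    using three_equilibria_example by simp
  have five: "(1 :: real) \<noteq> 0 \<and> (1 :: real) \<noteq> 0 \<and> (1 :: real) \<noteq> 0 \<and> 1 * 1 + 0 * 0 \<noteq> (0 :: real)
      \<and> card (equilibria 1 1 1 1 0 0) = 5"
    using five_equilibria_example by simp
  show "\<forall>n\<in>{1, 3, 5}. \<exists>a' b' c' d' e' k' :: real.
      a' \<noteq> 0 \<and> b' \<noteq> 0 \<and> d' \<noteq> e' \<and> c' * d' + e' * k' \<noteq> 0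
      \<and> card (equilibria a' b' c' d' e' k') = n"
    using one three five by blast
qed

end
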